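(* Let $M$ be a module over a ring and let $A,B$ be direct summands of $M$. If every complement of $A$ in $M$ is perspective with $B$, then every complement of $B$ in $M$ is perspective with $A$.
   Context: Rings are associative with unity and modules are unital. A complement of a direct summand $A$ of $M$ is a submodule $C$ with $M=A\oplus C$. Two direct summands of $M$ are perspective if they have a common complement in $M$. *)

theory Defs
  imports "HOL-Algebra.Module" "HOL-Algebra.AbelCoset"
begin

text \<open>
  The locale \<^locale>\<open>module\<close> requires a commutative ring of scalars; the following locale has
  the same axioms over an arbitrary unital ring. Right modules are covered by taking the
  opposite ring as the ring of scalars. The multiplication fields of the record \<open>M\<close>
  play no role.
\<close>

locale left_module = R?: ring R + M?: abelian_group M for R (structure) and M (structure) +
  assumes smult_closed [simp, intro]:
      "\<lbrakk>a \<in> carrier R; x \<in> carrier M\<rbrakk> \<Longrightarrow> a \<odot>\<^bsub>M\<^esub> x \<in> carrier M"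
    and smult_l_distr:
      "\<lbrakk>a \<in> carrier R; b \<in> carrier R; x \<in> carrier M\<rbrakk> \<Longrightarrow>
        (a \<oplus> b) \<odot>\<^bsub>M\<^esub> x = a \<odot>\<^bsub>M\<^esub> x \<oplus>\<^bsub>M\<^esub> b \<odot>\<^bsub>M\<^esub> x"
    and smult_r_distr:
      "\<lbrakk>a \<in> carrier R; x \<in> carrier M; y \<in> carrier M\<rbrakk> \<Longrightarrow>
        a \<odot>\<^bsub>M\<^esub> (x \<oplus>\<^bsub>M\<^esub> y) = a \<odot>\<^bsub>M\<^esub> x \<oplus>\<^bsub>M\<^esub> a \<odot>\<^bsub>M\<^esub> y"
    and smult_assoc1:
      "\<lbrakk>a \<in> carrier R; b \<in> carrier R; x \<in> carrier M\<rbrakk> \<Longrightarrow>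
        (a \<otimes> b) \<odot>\<^bsub>M\<^esub> x = a \<odot>\<^bsub>M\<^esub> (b \<odot>\<^bsub>M\<^esub> x)"
    and smult_one [simp]:
      "x \<in> carrier M \<Longrightarrow> \<one> \<odot>\<^bsub>M\<^esub> x = x"

lemma module_imp_left_module: "module R M \<Longrightarrow> left_module R M"
  unfolding module_def left_module_def module_axioms_def left_module_axioms_def
  by (simp add: cring.axioms(1))

text \<open>
  The predicate \<^term>\<open>submodule\<close> of the library does not presuppose commutativity of the
  scalars: it says additive subgroup closed under scalar multiplication.
\<close>

definition direct_sum_decomp ::
    "('a, 'r) ring_scheme \<Rightarrow> ('a, 'b, 'm) module_scheme \<Rightarrow> 'b set \<Rightarrow> 'b set \<Rightarrow> bool" where
  "direct_sum_decomp R M A C \<longleftrightarrow>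
     submodule A R M \<and> submodule C R M \<and>
     A <+>\<^bsub>M\<^esub> C = carrier M \<and> A \<inter> C = {\<zero>\<^bsub>M\<^esub>}"

definition direct_summand ::
    "('a, 'r) ring_scheme \<Rightarrow> ('a, 'b, 'm) module_scheme \<Rightarrow> 'b set \<Rightarrow> bool" where
  "direct_summand R M A \<longleftrightarrow> (\<exists>C. direct_sum_decomp R M A C)"

definition is_complement ::
    "('a, 'r) ring_scheme \<Rightarrow> ('a, 'b, 'm) module_scheme \<Rightarrow> 'b set \<Rightarrow> 'b set \<Rightarrow> bool" where
  "is_complement R M A C \<longleftrightarrow> direct_sum_decomp R M A C"

text \<open>A common complement forces both submodules to be direct summands.\<close>

definition perspective ::
    "('a, 'r) ring_scheme \<Rightarrow> ('a, 'b, 'm) module_scheme \<Rightarrow> 'b set \<Rightarrow> 'b set \<Rightarrow> bool" where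
  "perspective R M A B \<longleftrightarrow> (\<exists>C. is_complement R M A C \<and> is_complement R M B C)"

end

theory Submission
  imports Defs
begin

text \<open>
  Fix a complement \<open>D\<close> of \<open>B\<close>, let \<open>f\<close> be the projection onto \<open>D\<close> along \<open>B\<close> and \<open>e\<close> a projection
  onto \<open>A\<close>. The map \<open>p = e (f + e - f e)\<close> is again a projection onto \<open>A\<close>, so by hypothesis its
  kernel and \<open>B\<close> have a common complement \<open>E\<close>. With \<open>s\<close> the projection onto \<open>E\<close> along \<open>ker p\<close>, the
  map \<open>q = f + f (1 - e) s e (1 - f)\<close> is a projection onto \<open>D\<close>, and it restricts to an isomorphism
  from \<open>A\<close> onto \<open>D\<close>. Hence \<open>ker q\<close> is a common complement of \<open>D\<close> and \<open>A\<close>. The formulas come from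
  the proof that the stable range one condition is left-right symmetric.
\<close>

section \<open>Endomorphisms, kernels and projections\<close>

definition module_endo ::
    "('a, 'r) ring_scheme \<Rightarrow> ('a, 'b, 'm) module_scheme \<Rightarrow> ('b \<Rightarrow> 'b) \<Rightarrow> bool" where
  "module_endo R M f \<longleftrightarrow>
     (\<forall>x\<in>carrier M. f x \<in> carrier M) \<and>
     (\<forall>x\<in>carrier M. \<forall>y\<in>carrier M. f (x \<oplus>\<^bsub>M\<^esub> y) = f x \<oplus>\<^bsub>M\<^esub> f y) \<and>
     (\<forall>a\<in>carrier R. \<forall>x\<in>carrier M. f (a \<odot>\<^bsub>M\<^esub> x) = a \<odot>\<^bsub>M\<^esub> f x)"

definition endo_kernel :: "('a, 'b, 'm) module_scheme \<Rightarrow> ('b \<Rightarrow> 'b) \<Rightarrow> 'b set" where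
  "endo_kernel M f = {x \<in> carrier M. f x = \<zero>\<^bsub>M\<^esub>}"

definition is_projection ::
    "('a, 'r) ring_scheme \<Rightarrow> ('a, 'b, 'm) module_scheme \<Rightarrow> 'b set \<Rightarrow> 'b set \<Rightarrow> ('b \<Rightarrow> 'b) \<Rightarrow> bool" where
  "is_projection R M A C p \<longleftrightarrow>
     module_endo R M p \<and> (\<forall>x\<in>carrier M. p x \<in> A) \<and> (\<forall>x\<in>A. p x = x) \<and> endo_kernel M p = C"

lemma mem_set_add_iff: "x \<in> A <+>\<^bsub>M\<^esub> C \<longleftrightarrow> (\<exists>a\<in>A. \<exists>c\<in>C. x = a \<oplus>\<^bsub>M\<^esub> c)"
  by (simp add: set_add_def set_mult_def)

lemma submodule_subset: "submodule A R M \<Longrightarrow> x \<in> A \<Longrightarrow> x \<in> carrier M"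
  using subgroup.mem_carrier[OF submodule.axioms(1)] by fastforce

lemma submodule_add: "submodule A R M \<Longrightarrow> x \<in> A \<Longrightarrow> y \<in> A \<Longrightarrow> x \<oplus>\<^bsub>M\<^esub> y \<in> A"
  using subgroup.m_closed[OF submodule.axioms(1)] by fastforce

lemma submodule_neg: "submodule A R M \<Longrightarrow> x \<in> A \<Longrightarrow> \<ominus>\<^bsub>M\<^esub> x \<in> A"
  using subgroup.m_inv_closed[OF submodule.axioms(1)] by (fastforce simp: a_inv_def)

lemma submodule_zero: "submodule A R M \<Longrightarrow> \<zero>\<^bsub>M\<^esub> \<in> A"
  using subgroup.one_closed[OF submodule.axioms(1)] by fastforce

lemma submodule_smult: "submodule A R M \<Longrightarrow> a \<in> carrier R \<Longrightarrow> x \<in> A \<Longrightarrow> a \<odot>\<^bsub>M\<^esub> x \<in> A"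
  by (simp add: submodule.smult_closed)

lemma module_endo_closed: "module_endo R M f \<Longrightarrow> x \<in> carrier M \<Longrightarrow> f x \<in> carrier M"
  and module_endo_add:
    "module_endo R M f \<Longrightarrow> x \<in> carrier M \<Longrightarrow> y \<in> carrier M \<Longrightarrow> f (x \<oplus>\<^bsub>M\<^esub> y) = f x \<oplus>\<^bsub>M\<^esub> f y"
  and module_endo_smult:
    "module_endo R M f \<Longrightarrow> a \<in> carrier R \<Longrightarrow> x \<in> carrier M \<Longrightarrow> f (a \<odot>\<^bsub>M\<^esub> x) = a \<odot>\<^bsub>M\<^esub> f x"
  by (simp_all add: module_endo_def)

lemma module_endo_id: "module_endo R M (\<lambda>x. x)"
  by (simp add: module_endo_def)

lemma module_endo_compose:
  "module_endo R M f \<Longrightarrow> module_endo R M g \<Longrightarrow> module_endo R M (\<lambda>x. f (g x))"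
  by (simp add: module_endo_def)

section \<open>Arithmetic of endomorphisms over an arbitrary ring\<close>

context left_module
begin

lemma module_endo_zero: "module_endo R M f \<Longrightarrow> f \<zero>\<^bsub>M\<^esub> = \<zero>\<^bsub>M\<^esub>"
  by (metis M.r_zero M.zero_closed M.add.l_cancel_one module_endo_add module_endo_closed)

lemma module_endo_neg:
  assumes f: "module_endo R M f" and x: "x \<in> carrier M"
  shows "f (\<ominus>\<^bsub>M\<^esub> x) = \<ominus>\<^bsub>M\<^esub> f x"
proof -
  have "f (\<ominus>\<^bsub>M\<^esub> x) \<oplus>\<^bsub>M\<^esub> f x = \<zero>\<^bsub>M\<^esub>"
    using module_endo_add[OF f, of "\<ominus>\<^bsub>M\<^esub> x" x] x by (simp add: M.l_neg module_endo_zero[OF f])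
  then show ?thesis using f x by (simp add: M.minus_equality module_endo_closed)
qed

lemma module_endo_diff:
  "module_endo R M f \<Longrightarrow> x \<in> carrier M \<Longrightarrow> y \<in> carrier M \<Longrightarrow> f (x \<ominus>\<^bsub>M\<^esub> y) = f x \<ominus>\<^bsub>M\<^esub> f y"
  by (simp add: a_minus_def module_endo_add module_endo_neg)

lemma smult_zero: "a \<in> carrier R \<Longrightarrow> a \<odot>\<^bsub>M\<^esub> \<zero>\<^bsub>M\<^esub> = \<zero>\<^bsub>M\<^esub>"
  by (metis M.zero_closed M.add.l_cancel_one smult_closed smult_r_distr)

lemma smult_neg:
  assumes "a \<in> carrier R" "x \<in> carrier M"
  shows "a \<odot>\<^bsub>M\<^esub> (\<ominus>\<^bsub>M\<^esub> x) = \<ominus>\<^bsub>M\<^esub> (a \<odot>\<^bsub>M\<^esub> x)"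
proof -
  have "a \<odot>\<^bsub>M\<^esub> (\<ominus>\<^bsub>M\<^esub> x) \<oplus>\<^bsub>M\<^esub> a \<odot>\<^bsub>M\<^esub> x = \<zero>\<^bsub>M\<^esub>"
    using assms smult_r_distr[of a "\<ominus>\<^bsub>M\<^esub> x" x] by (simp add: M.l_neg smult_zero)
  then show ?thesis using assms by (simp add: M.minus_equality)
qed

lemma module_endo_sum:
  assumes "module_endo R M f" "module_endo R M g"
  shows "module_endo R M (\<lambda>x. f x \<oplus>\<^bsub>M\<^esub> g x)"
  using assms by (simp add: module_endo_def smult_r_distr M.a_ac)

lemma module_endo_difference:
  assumes "module_endo R M f" "module_endo R M g"
  shows "module_endo R M (\<lambda>x. f x \<ominus>\<^bsub>M\<^esub> g x)"
  using assms by (simp add: module_endo_def smult_r_distr smult_neg a_minus_def M.a_ac M.minus_add)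

lemma submodule_endo_kernel:
  assumes "module_endo R M f"
  shows "submodule (endo_kernel M f) R M"
proof unfold_locales
qed (use assms in \<open>auto simp: endo_kernel_def module_endo_add module_endo_smult module_endo_zero
    smult_zero module_endo_neg[OF assms] simp flip: a_inv_def\<close>)

lemma diff_cancel: "x \<in> carrier M \<Longrightarrow> y \<in> carrier M \<Longrightarrow> x \<oplus>\<^bsub>M\<^esub> (y \<ominus>\<^bsub>M\<^esub> x) = y"
  by (simp add: a_minus_def M.a_comm[of y] M.r_neg2)

lemma diff_eq_zero_iff:
  "x \<in> carrier M \<Longrightarrow> y \<in> carrier M \<Longrightarrow> x \<ominus>\<^bsub>M\<^esub> y = \<zero>\<^bsub>M\<^esub> \<longleftrightarrow> x = y"
  by (metis M.r_neg a_minus_def diff_cancel)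

text \<open>Sorting by \<open>M.a_ac\<close> can leave a summand and its negative non-adjacent; this
  cancels such a pair across one intermediate term.\<close>

lemma add_neg_cancel:
  assumes "x \<in> carrier M" "y \<in> carrier M" "z \<in> carrier M"
  shows "x \<oplus>\<^bsub>M\<^esub> (y \<oplus>\<^bsub>M\<^esub> (\<ominus>\<^bsub>M\<^esub> x \<oplus>\<^bsub>M\<^esub> z)) = y \<oplus>\<^bsub>M\<^esub> z"
  using assms by (simp add: M.a_lcomm[of y] M.r_neg2)

section \<open>Complements and projections\<close>

lemma is_complement_commute:
  assumes "is_complement R M A C"
  shows "is_complement R M C A"
proof -
  have "A <+>\<^bsub>M\<^esub> C = C <+>\<^bsub>M\<^esub> A"
    using assms unfolding is_complement_def direct_sum_decomp_def set_eq_iff mem_set_add_iff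
    by (metis M.a_comm submodule_subset)
  then show ?thesis
    using assms by (auto simp: is_complement_def direct_sum_decomp_def)
qed

text \<open>If \<open>q\<close> restricts to a bijection from \<open>A\<close> onto \<open>D\<close>
  with inverse \<open>w\<close>, then \<open>w (q x)\<close> is the \<open>A\<close>-component of
  \<open>x\<close> and \<open>x \<ominus> w (q x)\<close> lies in the kernel. An element of
  \<open>A\<close> killed by \<open>q\<close> equals \<open>w \<zero>\<close>, hence is
  zero.\<close>

lemma is_complement_endo_kernel:
  assumes "submodule A R M" "module_endo R M q" "module_endo R M w"
    and "\<And>x. x \<in> carrier M \<Longrightarrow> q x \<in> D" "\<And>y. y \<in> D \<Longrightarrow> w y \<in> A"
    and "\<And>y. y \<in> D \<Longrightarrow> q (w y) = y" "\<And>x. x \<in> A \<Longrightarrow> w (q x) = x"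
  shows "is_complement R M A (endo_kernel M q)"
proof -
  note [simp] = module_endo_closed[OF assms(2)] module_endo_closed[OF assms(3)]
  have "x \<in> A <+>\<^bsub>M\<^esub> endo_kernel M q" if x: "x \<in> carrier M" for x
  proof -
    have "x \<ominus>\<^bsub>M\<^esub> w (q x) \<in> endo_kernel M q"
      using x assms(4,6) by (simp add: endo_kernel_def module_endo_diff[OF assms(2)])
        (simp add: a_minus_def M.r_neg)
    moreover have "x = w (q x) \<oplus>\<^bsub>M\<^esub> (x \<ominus>\<^bsub>M\<^esub> w (q x))"
      using x by (simp add: diff_cancel)
    ultimately show ?thesis
      using assms(4,5) x unfolding mem_set_add_iff by blast
  qed
  moreover have "A <+>\<^bsub>M\<^esub> endo_kernel M q \<subseteq> carrier M"
    using submodule_subset[OF assms(1)]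
    by (auto simp: mem_set_add_iff endo_kernel_def)
  moreover have "A \<inter> endo_kernel M q \<subseteq> {\<zero>\<^bsub>M\<^esub>}"
    using assms(7) module_endo_zero[OF assms(3)] by (force simp: endo_kernel_def)
  moreover have "\<zero>\<^bsub>M\<^esub> \<in> A \<inter> endo_kernel M q"
    using submodule_zero assms(1) submodule_endo_kernel[OF assms(2)] by blast
  ultimately show ?thesis
    using assms(1) submodule_endo_kernel[OF assms(2)]
    by (auto simp: is_complement_def direct_sum_decomp_def)
qed

text \<open>The preceding criterion with \<open>D = A\<close> and the identity as inverse.\<close>

lemma is_projection_imp_complement:
  assumes "submodule A R M" "is_projection R M A C p"
  shows "is_complement R M A C"
  using is_complement_endo_kernel[OF assms(1) _ module_endo_id, of p A] assms(2)
  by (auto simp: is_projection_def)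

text \<open>The \<open>A\<close>-component of an element is unique because two candidates differ by
  an element of \<open>A \<inter> C\<close>. Uniqueness makes the chosen component additive and
  linear.\<close>

lemma is_complement_obtain_projection:
  assumes "is_complement R M A C"
  obtains p where "is_projection R M A C p"
proof -
  have A: "submodule A R M" and C: "submodule C R M"
    and dec: "A <+>\<^bsub>M\<^esub> C = carrier M" and int: "A \<inter> C = {\<zero>\<^bsub>M\<^esub>}"
    using assms by (auto simp: is_complement_def direct_sum_decomp_def)
  note Ac [simp] = submodule_subset[OF A] and Cc [simp] = submodule_subset[OF C]
  have ex: "\<exists>a\<in>A. \<exists>c\<in>C. x = a \<oplus>\<^bsub>M\<^esub> c" if "x \<in> carrier M" for x
    using that unfolding dec[symmetric] mem_set_add_iff .
  have uniq: "a = a'" if "a \<in> A" "c \<in> C" "a' \<in> A" "c' \<in> C" "a \<oplus>\<^bsub>M\<^esub> c = a' \<oplus>\<^bsub>M\<^esub> c'" for a c a' c'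
  proof -
    have "a \<ominus>\<^bsub>M\<^esub> a' = ((a \<oplus>\<^bsub>M\<^esub> c) \<ominus>\<^bsub>M\<^esub> c) \<ominus>\<^bsub>M\<^esub> a'"
      using that(1-4) by (simp add: a_minus_def M.a_assoc M.r_neg)
    also have "\<dots> = c' \<ominus>\<^bsub>M\<^esub> c"
      unfolding that(5) using that(1-4) by (simp add: a_minus_def M.a_ac add_neg_cancel)
    finally have "a \<ominus>\<^bsub>M\<^esub> a' \<in> A \<inter> C"
      using that A C by (metis IntI a_minus_def submodule_add submodule_neg)
    then show ?thesis
      using int that by (simp add: diff_eq_zero_iff)
  qed
  define p where "p x = (SOME a. a \<in> A \<and> (\<exists>c\<in>C. x = a \<oplus>\<^bsub>M\<^esub> c))" for x
  have p: "p x \<in> A \<and> (\<exists>c\<in>C. x = p x \<oplus>\<^bsub>M\<^esub> c)" if "x \<in> carrier M" for x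
    unfolding p_def using ex[OF that] unfolding Bex_def[of A] by (rule someI_ex)
  have peq: "p (a \<oplus>\<^bsub>M\<^esub> c) = a" if "a \<in> A" "c \<in> C" for a c
    using p[of "a \<oplus>\<^bsub>M\<^esub> c"] uniq that by (metis Ac Cc M.add.m_closed)
  have "module_endo R M p"
    unfolding module_endo_def
  proof (intro conjI ballI)
    fix x y assume x: "x \<in> carrier M" and y: "y \<in> carrier M"
    obtain a c a' c' where 1: "a \<in> A" "c \<in> C" "x = a \<oplus>\<^bsub>M\<^esub> c" "a' \<in> A" "c' \<in> C" "y = a' \<oplus>\<^bsub>M\<^esub> c'"
      using ex x y by meson
    then have "x \<oplus>\<^bsub>M\<^esub> y = (a \<oplus>\<^bsub>M\<^esub> a') \<oplus>\<^bsub>M\<^esub> (c \<oplus>\<^bsub>M\<^esub> c')"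
      by (simp add: M.a_ac)
    then show "p (x \<oplus>\<^bsub>M\<^esub> y) = p x \<oplus>\<^bsub>M\<^esub> p y"
      using 1 peq submodule_add[OF A] submodule_add[OF C] by simp
  next
    fix r x assume r: "r \<in> carrier R" and x: "x \<in> carrier M"
    obtain a c where 1: "a \<in> A" "c \<in> C" "x = a \<oplus>\<^bsub>M\<^esub> c"
      using ex x by meson
    then show "p (r \<odot>\<^bsub>M\<^esub> x) = r \<odot>\<^bsub>M\<^esub> p x"
      using r peq submodule_smult[OF A] submodule_smult[OF C] by (simp add: smult_r_distr)
  qed (use p in auto)
  moreover have "p x = x" if "x \<in> A" for x
    using peq[OF that submodule_zero[OF C]] that by simp
  moreover have "endo_kernel M p = C"
  proof
    show "endo_kernel M p \<subseteq> C" using p by (fastforce simp: endo_kernel_def)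
    show "C \<subseteq> endo_kernel M p"
      using peq[OF submodule_zero[OF A]] by (auto simp: endo_kernel_def)
  qed
  ultimately show ?thesis
    using p by (intro that) (auto simp: is_projection_def)
qed

text \<open>The element \<open>x \<ominus> p x\<close> lies in the kernel of \<open>p\<close>, so
  \<open>g\<close> kills it. Applied in both directions to two projections with the same kernel,
  this shows that each is unchanged by precomposition with the other.\<close>

lemma endo_projection_absorb:
  assumes "is_projection R M A C p" "module_endo R M g" "C \<subseteq> endo_kernel M g" "x \<in> carrier M"
  shows "g (p x) = g x"
proof -
  have p: "module_endo R M p" "p (p x) = p x" "endo_kernel M p = C"
    using assms(1,4) by (auto simp: is_projection_def)
  have "x \<ominus>\<^bsub>M\<^esub> p x \<in> endo_kernel M p"
    using assms(4) p(1,2) by (simp add: endo_kernel_def module_endo_diff[OF p(1)] module_endo_closed[OF p(1)]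
        diff_eq_zero_iff)
  then have "g (x \<ominus>\<^bsub>M\<^esub> p x) = \<zero>\<^bsub>M\<^esub>"
    using assms(3) p(3) by (auto simp: endo_kernel_def)
  then show ?thesis
    using assms p by (simp add: module_endo_diff[OF assms(2)] module_endo_closed[OF assms(2)]
        module_endo_closed[OF p(1)] diff_eq_zero_iff)
qed

section \<open>Construction of the common complement\<close>

lemma perspective_of_complement:
  assumes A: "direct_summand R M A"
    and persp: "\<And>C. is_complement R M A C \<Longrightarrow> perspective R M C B"
    and D: "is_complement R M B D"
  shows "perspective R M D A"
proof -
  obtain C where C: "is_complement R M A C"
    using A by (auto simp: direct_summand_def is_complement_def)
  obtain e where e: "is_projection R M A C e"
    using C by (rule is_complement_obtain_projection)
  obtain f where f: "is_projection R M D B f"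
    using is_complement_commute[OF D] by (rule is_complement_obtain_projection)
  have subA: "submodule A R M" and subD: "submodule D R M"
    using C D by (auto simp: is_complement_def direct_sum_decomp_def)
  have endo_e: "module_endo R M e" and endo_f: "module_endo R M f"
    using e f by (auto simp: is_projection_def)
  note [simp] = module_endo_closed[OF endo_e] module_endo_closed[OF endo_f]
  have e_in: "e x \<in> A" and f_in: "f x \<in> D" if "x \<in> carrier M" for x
    using e f that by (auto simp: is_projection_def)
  have eA: "e x = x" if "x \<in> A" for x
    using e that by (auto simp: is_projection_def)
  have fD: "f x = x" if "x \<in> D" for x
    using f that by (auto simp: is_projection_def)

  \<comment> \<open>On \<open>A\<close> the two \<open>f\<close>-terms cancel, so \<open>p\<close>
    fixes \<open>A\<close> like \<open>e\<close> does; only the kernel changes, and it now depends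
    on \<open>D\<close>.\<close>
  define p where "p x = e (f x \<oplus>\<^bsub>M\<^esub> (e x \<ominus>\<^bsub>M\<^esub> f (e x)))" for x
  have endo_p: "module_endo R M p"
    unfolding p_def using endo_e endo_f
    by (intro module_endo_compose[OF endo_e] module_endo_sum module_endo_difference
        module_endo_compose[OF endo_f] module_endo_id)
  have pA: "p x = x" if "x \<in> A" for x
    using that submodule_subset[OF subA that] endo_f by (simp add: p_def eA diff_cancel)
  have p: "is_projection R M A (endo_kernel M p) p"
    using endo_p pA endo_e endo_f by (auto simp: is_projection_def p_def intro!: e_in)
  \<comment> \<open>The hypothesis on all complements of \<open>A\<close> is applied to the kernel
    of \<open>p\<close>, in place of the initial complement \<open>C\<close>.\<close>
  obtain E where E: "is_complement R M (endo_kernel M p) E" "is_complement R M B E"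
    using persp[OF is_projection_imp_complement[OF subA p]] by (auto simp: perspective_def)
  obtain s where s: "is_projection R M E (endo_kernel M p) s"
    using is_complement_commute[OF E(1)] by (rule is_complement_obtain_projection)
  obtain r where r: "is_projection R M E B r"
    using is_complement_commute[OF E(2)] by (rule is_complement_obtain_projection)
  have endo_s: "module_endo R M s" and endo_r: "module_endo R M r"
    using s r by (auto simp: is_projection_def)
  have sE: "s x = x" and rE: "r x = x" if "x \<in> E" for x
    using s r that by (auto simp: is_projection_def)
  have s_in: "s x \<in> E" and r_in: "r x \<in> E" if "x \<in> carrier M" for x
    using s r that by (auto simp: is_projection_def)
  \<comment> \<open>The maps \<open>f\<close> and \<open>r\<close> share the kernel
    \<open>B\<close>, and \<open>p\<close> and \<open>s\<close> share the kernel of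
    \<open>p\<close>. Hence \<open>f\<close> maps \<open>E\<close> isomorphically onto
    \<open>D\<close> with inverse \<open>r\<close>, and \<open>p\<close> maps \<open>E\<close>
    isomorphically onto \<open>A\<close> with inverse \<open>s\<close>.\<close>
  have fr: "f (r x) = f x" and rf: "r (f x) = r x"
    and ps: "p (s x) = p x" and sp: "s (p x) = s x" if "x \<in> carrier M" for x
    using endo_projection_absorb[OF r endo_f _ that] endo_projection_absorb[OF f endo_r _ that]
      endo_projection_absorb[OF s endo_p _ that] endo_projection_absorb[OF p endo_s _ that] f r s
    by (auto simp: is_projection_def)
  note [simp] = module_endo_closed[OF endo_s] module_endo_closed[OF endo_r]

  define q where "q x = f x \<oplus>\<^bsub>M\<^esub> f (s (e (x \<ominus>\<^bsub>M\<^esub> f x)) \<ominus>\<^bsub>M\<^esub> e (s (e (x \<ominus>\<^bsub>M\<^esub> f x))))" for x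
  \<comment> \<open>The formula e + e r (1 - e), which will invert the restriction of
    \<open>q\<close> to \<open>A\<close>.\<close>
  define w where "w x = e x \<oplus>\<^bsub>M\<^esub> e (r (x \<ominus>\<^bsub>M\<^esub> e x))" for x
  have endo_q: "module_endo R M q"
    unfolding q_def using endo_e endo_f
    by (intro module_endo_sum module_endo_compose[OF endo_f] module_endo_difference
        module_endo_compose[OF endo_s] module_endo_compose[OF endo_e] module_endo_id)
  have endo_w: "module_endo R M w"
    unfolding w_def using endo_e
    by (intro module_endo_sum module_endo_compose[OF endo_r] module_endo_difference
        module_endo_compose[OF endo_e] module_endo_id)
  have q_in: "q x \<in> D" if "x \<in> carrier M" for x
    unfolding q_def using that by (intro submodule_add[OF subD] f_in) auto
  have w_in: "w x \<in> A" if "x \<in> carrier M" for x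
    unfolding w_def using that by (intro submodule_add[OF subA] e_in) auto
  \<comment> \<open>The correction term of \<open>q\<close> starts with 1 - f, which vanishes on
    \<open>D\<close>.\<close>
  have qD: "q x = x" if "x \<in> D" for x
  proof -
    have "x \<ominus>\<^bsub>M\<^esub> f x = \<zero>\<^bsub>M\<^esub>" "\<zero>\<^bsub>M\<^esub> \<ominus>\<^bsub>M\<^esub> \<zero>\<^bsub>M\<^esub> = \<zero>\<^bsub>M\<^esub>"
      using that submodule_subset[OF subD that] by (simp_all add: fD diff_eq_zero_iff)
    then show ?thesis
      using that submodule_subset[OF subD that]
      by (simp add: q_def fD module_endo_zero endo_e endo_f endo_s)
  qed
  have qw: "q (w d) = d" if dD: "d \<in> D" for d
  proof -
    have d [simp]: "d \<in> carrier M" using submodule_subset[OF subD dD] .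
    \<comment> \<open>This element of \<open>E\<close> satisfies
      \<open>f \<rho> = d \<ominus> f (e d)\<close>. That identity turns e (1 - f) applied to
      \<open>w d\<close> into \<open>p \<rho>\<close>, from which \<open>s\<close> recovers
      \<open>\<rho>\<close>.\<close>
    define \<rho> where "\<rho> = r (d \<ominus>\<^bsub>M\<^esub> e d)"
    have \<rho> [simp]: "\<rho> \<in> carrier M" and \<rho>E: "\<rho> \<in> E" by (simp_all add: \<rho>_def r_in)
    have f\<rho>: "f \<rho> = d \<ominus>\<^bsub>M\<^esub> f (e d)"
      by (simp add: \<rho>_def fr module_endo_diff[OF endo_f] fD dD)
    have w: "w d = e d \<oplus>\<^bsub>M\<^esub> e \<rho>" by (simp add: w_def \<rho>_def)
    have "e (w d \<ominus>\<^bsub>M\<^esub> f (w d)) = p \<rho>"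
      by (simp add: w p_def f\<rho> module_endo_add[OF endo_e] module_endo_add[OF endo_f]
          module_endo_diff[OF endo_e] module_endo_diff[OF endo_f] eA e_in)
        (simp add: a_minus_def M.minus_add M.a_ac)
    then have "s (e (w d \<ominus>\<^bsub>M\<^esub> f (w d))) = \<rho>"
      by (simp add: sp sE \<rho>E)
    then have "q (w d) = f (e d \<oplus>\<^bsub>M\<^esub> e \<rho>) \<oplus>\<^bsub>M\<^esub> f (\<rho> \<ominus>\<^bsub>M\<^esub> e \<rho>)"
      by (simp add: q_def w)
    also have "\<dots> = f (e d) \<oplus>\<^bsub>M\<^esub> (f (e \<rho>) \<oplus>\<^bsub>M\<^esub> (f \<rho> \<ominus>\<^bsub>M\<^esub> f (e \<rho>)))"
      by (simp add: module_endo_add[OF endo_f] module_endo_diff[OF endo_f] M.a_assoc)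
    also have "\<dots> = d"
      by (simp add: diff_cancel) (simp add: f\<rho> diff_cancel)
    finally show ?thesis .
  qed
  have wq: "w (q a) = a" if aA: "a \<in> A" for a
  proof -
    have a [simp]: "a \<in> carrier M" using submodule_subset[OF subA aA] .
    \<comment> \<open>This is the element of \<open>E\<close> that \<open>p\<close> sends to
      \<open>e (a \<ominus> f a)\<close>. Expanding \<open>p k\<close> shows that \<open>e k\<close>
      is exactly what \<open>e (q a)\<close> lacks to give \<open>a\<close>.\<close>
    define k where "k = s (e (a \<ominus>\<^bsub>M\<^esub> f a))"
    have k [simp]: "k \<in> carrier M" and kE: "k \<in> E" by (simp_all add: k_def s_in)
    have q: "q a = f (a \<oplus>\<^bsub>M\<^esub> (k \<ominus>\<^bsub>M\<^esub> e k))"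
      by (simp add: q_def k_def module_endo_add[OF endo_f])
    have "p k = e (a \<ominus>\<^bsub>M\<^esub> f a)"
      by (simp add: k_def ps pA e_in)
    then have pk: "e (f k) \<oplus>\<^bsub>M\<^esub> (e k \<ominus>\<^bsub>M\<^esub> e (f (e k))) = a \<ominus>\<^bsub>M\<^esub> e (f a)"
      by (simp add: p_def module_endo_add[OF endo_e] module_endo_diff[OF endo_e] eA e_in aA)
    have "e (q a) \<oplus>\<^bsub>M\<^esub> e k = e (f a) \<oplus>\<^bsub>M\<^esub> (e (f k) \<oplus>\<^bsub>M\<^esub> (e k \<ominus>\<^bsub>M\<^esub> e (f (e k))))"
      by (simp add: q module_endo_add[OF endo_e] module_endo_add[OF endo_f]
          module_endo_diff[OF endo_e] module_endo_diff[OF endo_f])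
        (simp add: a_minus_def M.a_ac)
    also have "\<dots> = a"
      by (simp add: pk diff_cancel)
    finally have eq: "e (q a) \<oplus>\<^bsub>M\<^esub> e k = a" .
    have qa [simp]: "q a \<in> carrier M" by (simp add: q)
    \<comment> \<open>Since r f = r, the outer \<open>f\<close> in \<open>q a\<close> disappears
      under \<open>r\<close>. Writing \<open>a\<close> as \<open>e (q a) \<oplus> e k\<close> then
      cancels the \<open>r (e k)\<close> terms and isolates \<open>k\<close>, because
      \<open>r\<close> fixes \<open>E\<close>.\<close>
    have "r (q a) = r (e (q a) \<oplus>\<^bsub>M\<^esub> e k) \<oplus>\<^bsub>M\<^esub> (r k \<ominus>\<^bsub>M\<^esub> r (e k))"
      unfolding eq by (simp add: q rf module_endo_add[OF endo_r] module_endo_diff[OF endo_r])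
    also have "\<dots> = r (e (q a)) \<oplus>\<^bsub>M\<^esub> (r (e k) \<oplus>\<^bsub>M\<^esub> (k \<ominus>\<^bsub>M\<^esub> r (e k)))"
      by (simp add: module_endo_add[OF endo_r] rE kE M.a_assoc)
    also have "\<dots> = r (e (q a)) \<oplus>\<^bsub>M\<^esub> k"
      by (simp add: diff_cancel)
    finally have "r (q a \<ominus>\<^bsub>M\<^esub> e (q a)) = k"
      by (simp add: module_endo_diff[OF endo_r]) (simp add: a_minus_def M.a_ac M.r_neg M.r_neg1 M.r_neg2 add_neg_cancel)
    then show ?thesis by (simp add: w_def eq)
  qed
  \<comment> \<open>The same kernel serves both submodules: for \<open>D\<close> the inverse is the
    identity, for \<open>A\<close> it is \<open>w\<close>.\<close>
  have "is_complement R M D (endo_kernel M q)"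
    using is_complement_endo_kernel[OF subD endo_q module_endo_id q_in] qD by blast
  moreover have "is_complement R M A (endo_kernel M q)"
    using is_complement_endo_kernel[OF subA endo_q endo_w q_in] w_in qw wq submodule_subset[OF subD]
    by blast
  ultimately show ?thesis
    by (auto simp: perspective_def)
qed

end

theorem proposition3p2:
  fixes R :: "('a, 'r) ring_scheme" and M :: "('a, 'b, 'm) module_scheme"
    and A B :: "'b set"
  assumes "left_module R M"
    and "direct_summand R M A"
    and "direct_summand R M B"
    and "\<forall>C. is_complement R M A C \<longrightarrow> perspective R M C B"
  shows "\<forall>D. is_complement R M B D \<longrightarrow> perspective R M D A"
  using left_module.perspective_of_complement[OF assms(1,2)] assms(4) by blast

end
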